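(* Let $A\in\mathbb{R}^{n\times n}$ be symmetric positive definite with largest eigenvalue $\lambda_1$, smallest eigenvalue $\lambda_n$, and condition number $\kappa=\lambda_1/\lambda_n$; let $b\in\mathbb{R}^n$, $f(x)=\tfrac12x^TAx-x^Tb$, $x^*=A^{-1}b$ and $f^*=f(x^* )=\min_x f(x)$. Fix $\ell\in\{0,\tfrac12,1,\tfrac32,2,\tfrac52,3,\dots\}$ and $\omega\in(0,2)$. Given an initial point $x_0\in\mathbb{R}^n$, let $(x_k)_{k\ge0}$ be the iterates of the Relaxed $\ell$-Minimal Gradient Descent method with relaxation parameter $\omega$. Let $\epsilon,\hat\epsilon>0$. Then: 1. $f(x_K)-f^*\le\epsilon$ for every integer $K\ge0$ with $$K>\frac{\kappa}{\omega(2-\omega)}\,\ln\frac{f(x_0)-f^*}{\epsilon};$$ 2. $f(x_{\hat K})-f^*\le\hat\epsilon$ for every integer $\hat K\ge0$ with $$\hat K>\frac{1}{\omega(2-\omega)}\,\frac{(\kappa+1)^2}{4\kappa}\,\ln\frac{\kappa^{2\ell}\,(f(x_0)-f^* )}{\hat\epsilon}.$$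
   Context: Half-integer powers of $A$ are defined through its unique positive definite square root $A^{1/2}$, and $A^0=I$. Relaxed $\ell$-Minimal Gradient Descent method (with relaxation parameter $\omega$): from $x_0\in\mathbb{R}^n$, for $k\ge 0$ set $g_k=\nabla f(x_k)=Ax_k-b$, $y_k=A^{\ell}g_k$, $\alpha_k=\dfrac{y_k^Ty_k}{y_k^TAy_k}$, and $x_{k+1}=x_k-\omega\alpha_k g_k$. If $g_k=0$ (so $x_k=x^*$), the step is taken to be zero, i.e. $\alpha_k:=0$ and $x_{k+1}=x_k$. If $f(x_0)=f^*$, the logarithms are read as $\ln 0=-\infty$ (so the conditions on $K$ and $\hat K$ hold trivially). *)

theory Defs
  imports "HOL-Analysis.Analysis"
begin

definition sym_posdef :: "real^'n^'n \<Rightarrow> bool" where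
  "sym_posdef A \<longleftrightarrow> transpose A = A \<and> (\<forall>x. x \<noteq> 0 \<longrightarrow> 0 < x \<bullet> (A *v x))"

definition eigenvalues :: "real^'n^'n \<Rightarrow> real set" where
  "eigenvalues A = {\<mu>. \<exists>v. v \<noteq> 0 \<and> A *v v = \<mu> *\<^sub>R v}"

text \<open>For a symmetric matrix the set of eigenvalues is finite and nonempty, so that
  \<open>Max\<close> and \<open>Min\<close> below are meaningful.\<close>

definition max_eigenvalue :: "real^'n^'n \<Rightarrow> real" where
  "max_eigenvalue A = Max (eigenvalues A)"

definition min_eigenvalue :: "real^'n^'n \<Rightarrow> real" where
  "min_eigenvalue A = Min (eigenvalues A)"

definition cond_number :: "real^'n^'n \<Rightarrow> real" where
  "cond_number A = max_eigenvalue A / min_eigenvalue A"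

text \<open>The operations \<open>*\<close> and \<open>^\<close> on \<open>real^'n^'n\<close> act componentwise, hence the explicit
  iteration of the matrix product.\<close>

definition mat_pow :: "real^'n^'n \<Rightarrow> nat \<Rightarrow> real^'n^'n" where
  "mat_pow A k = (((**) A) ^^ k) (mat 1)"

definition mat_sqrt :: "real^'n^'n \<Rightarrow> real^'n^'n" where
  "mat_sqrt A = (THE B. sym_posdef B \<and> B ** B = A)"

text \<open>The power \<open>A\<^sup>l\<close>, intended for \<open>l \<in> {0, 1/2, 1, 3/2, \<dots>}\<close> only.\<close>

definition mat_hpow :: "real^'n^'n \<Rightarrow> real \<Rightarrow> real^'n^'n" where
  "mat_hpow A l =
     (if l \<in> \<nat> then mat_pow A (nat \<lfloor>l\<rfloor>) else mat_pow A (nat \<lfloor>l\<rfloor>) ** mat_sqrt A)"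

definition quad_obj :: "real^'n^'n \<Rightarrow> real^'n \<Rightarrow> real^'n \<Rightarrow> real" where
  "quad_obj A b x = (1/2) * (x \<bullet> (A *v x)) - x \<bullet> b"

definition quad_grad :: "real^'n^'n \<Rightarrow> real^'n \<Rightarrow> real^'n \<Rightarrow> real^'n" where
  "quad_grad A b x = A *v x - b"

definition minimizer :: "real^'n^'n \<Rightarrow> real^'n \<Rightarrow> real^'n" where
  "minimizer A b = matrix_inv A *v b"

definition opt_value :: "real^'n^'n \<Rightarrow> real^'n \<Rightarrow> real" where
  "opt_value A b = quad_obj A b (minimizer A b)"

definition mgd_step_size :: "real^'n^'n \<Rightarrow> real^'n \<Rightarrow> real \<Rightarrow> real^'n \<Rightarrow> real" where
  "mgd_step_size A b l x =
     (let g = quad_grad A b x; y = mat_hpow A l *v g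
      in if g = 0 then 0 else (y \<bullet> y) / (y \<bullet> (A *v y)))"

primrec relaxed_mgd ::
  "real^'n^'n \<Rightarrow> real^'n \<Rightarrow> real \<Rightarrow> real \<Rightarrow> real^'n \<Rightarrow> nat \<Rightarrow> real^'n" where
  "relaxed_mgd A b l w x0 0 = x0"
| "relaxed_mgd A b l w x0 (Suc k) =
     (let x = relaxed_mgd A b l w x0 k
      in x - (w * mgd_step_size A b l x) *\<^sub>R quad_grad A b x)"

lemma sym_inner_commute:
  fixes A :: "real^'n^'n"
  assumes "transpose A = A"
  shows "x \<bullet> (A *v y) = (A *v x) \<bullet> y"
  by (metis assms dot_lmul_matrix vector_transpose_matrix)

lemma gderiv_quad_obj:
  fixes A :: "real^'n^'n"
  assumes "sym_posdef A"
  shows "GDERIV (quad_obj A b) x :> quad_grad A b x"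
proof -
  have t: "transpose A = A" using assms by (simp add: sym_posdef_def)
  have "(quad_obj A b has_derivative
          (\<lambda>h. (1/2) * (x \<bullet> (A *v h) + h \<bullet> (A *v x)) - h \<bullet> b)) (at x)"
    unfolding quad_obj_def[abs_def]
    by (auto intro!: derivative_eq_intros bounded_linear_imp_has_derivative
        simp: matrix_vector_mul_bounded_linear)
  moreover have "(\<lambda>h. (1/2) * (x \<bullet> (A *v h) + h \<bullet> (A *v x)) - h \<bullet> b)
      = (\<lambda>h. h \<bullet> quad_grad A b x)"
    by (rule ext)
      (simp add: sym_inner_commute[OF t, of x] quad_grad_def inner_diff_right inner_commute)
  ultimately show ?thesis by (simp add: gderiv_def)
qed

lemma mul_minimizer:
  fixes A :: "real^'n^'n"
  assumes "sym_posdef A"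
  shows "A *v minimizer A b = b"
proof -
  have "\<forall>x. A *v x = 0 \<longrightarrow> x = 0"
    using assms by (metis inner_zero_right less_irrefl sym_posdef_def)
  then have "invertible A"
    using invertible_left_inverse matrix_left_invertible_ker by blast
  then have "A ** matrix_inv A = mat 1"
    unfolding invertible_def matrix_inv_def by (rule someI2_ex) simp
  then show ?thesis
    by (metis matrix_vector_mul_assoc matrix_vector_mul_lid minimizer_def)
qed

lemma opt_value_le:
  fixes A :: "real^'n^'n"
  assumes "sym_posdef A"
  shows "opt_value A b \<le> quad_obj A b x"
proof -
  define s where "s = minimizer A b"
  have t: "transpose A = A" and s: "A *v s = b"
    using assms mul_minimizer[OF assms] by (auto simp: sym_posdef_def s_def)
  have "0 \<le> (x - s) \<bullet> (A *v (x - s))"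
    using assms by (cases "x = s") (auto simp: sym_posdef_def less_imp_le)
  also have "\<dots> = x \<bullet> (A *v x) - 2 * (x \<bullet> b) + s \<bullet> b"
    using sym_inner_commute[OF t, of s x] s
    by (simp add: matrix_vector_mult_diff_distrib inner_diff_left inner_diff_right inner_commute)
  finally show ?thesis
    by (simp add: opt_value_def quad_obj_def s flip: s_def)
qed

end

theory Submission
  imports Defs
begin

text \<open>In an orthonormal eigenbasis of \<open>A\<close> with eigenvalues \<open>\<mu>\<close>, put \<open>c = (v \<bullet> g)\<^sup>2\<close> for the
  coordinates of the gradient \<open>g\<close>, and \<open>\<Phi> j = (\<Sum> c * \<mu> ^ j / \<mu>)\<close>. A step multiplies each
  coordinate of \<open>g\<close> by \<open>1 - \<omega> * \<alpha> * \<mu>\<close>, where \<open>\<alpha> = (\<Sum> c * \<mu> ^ m) / (\<Sum> c * \<mu> ^ (m + 1))\<close> and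
  \<open>m = 2 * l\<close>. The gap \<open>f x - f\<^sup>*\<close> is \<open>\<Phi> 0 / 2\<close>. Chebyshev's sum inequality bounds \<open>\<alpha>\<close> by the step
  size of steepest descent, which makes \<open>\<Phi> 0\<close> contract by \<open>1 - \<omega> * (2 - \<omega>) / \<kappa>\<close>. On the other hand
  \<open>\<alpha>\<close> is the exact line search step for \<open>\<Phi> m\<close>, so Kantorovich's inequality makes \<open>\<Phi> m\<close> contract by
  \<open>1 - \<omega> * (2 - \<omega>) * 4 * \<kappa> / (\<kappa> + 1)\<^sup>2\<close>; comparing \<open>\<Phi> m\<close> with \<open>\<Phi> 0\<close> costs the factor \<open>\<kappa> ^ m\<close>.\<close>

section \<open>Weighted power sums\<close>

text \<open>Dividing \<open>(b - \<mu> v) * (\<mu> v - a) \<ge> 0\<close> by \<open>\<mu> v\<close>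
  gives \<open>\<mu> v + a * b / \<mu> v \<le> a + b\<close>. The weighted sum of these bounds is
  linear in the two sums \<open>?P\<close> and \<open>?Q\<close>, and the arithmetic-geometric mean
  inequality passes from \<open>?P + a * b * ?Q\<close> to their product.\<close>

lemma kantorovich_sum:
  fixes c \<mu> :: "'a \<Rightarrow> real"
  assumes "\<And>v. v \<in> E \<Longrightarrow> 0 \<le> c v" "0 < a"
    and "\<And>v. v \<in> E \<Longrightarrow> a \<le> \<mu> v" "\<And>v. v \<in> E \<Longrightarrow> \<mu> v \<le> b"
  shows "4 * (a * b) * ((\<Sum>v\<in>E. c v * \<mu> v) * (\<Sum>v\<in>E. c v / \<mu> v)) \<le> ((a + b) * (\<Sum>v\<in>E. c v))\<^sup>2"
proof (cases "E = {}")
  case False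
  then have ab: "a \<le> b" using assms(3,4) by fastforce
  let ?P = "\<Sum>v\<in>E. c v * \<mu> v" and ?Q = "\<Sum>v\<in>E. c v / \<mu> v"
  have pt: "c v * \<mu> v + a * b * (c v / \<mu> v) \<le> (a + b) * c v" if v: "v \<in> E" for v
  proof -
    have pos: "0 < \<mu> v" using assms(2,3) v by fastforce
    have "0 \<le> (b - \<mu> v) * (\<mu> v - a)" using assms(3,4) v by simp
    then have "\<mu> v + a * b / \<mu> v \<le> a + b"
      using pos by (simp add: field_simps)
    from mult_left_mono[OF this assms(1)[OF v]] show ?thesis
      by (simp add: algebra_simps)
  qed
  have le: "?P + a * b * ?Q \<le> (a + b) * (\<Sum>v\<in>E. c v)"
    using sum_mono[OF pt] by (simp add: sum.distrib sum_distrib_left)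
  have nn: "0 \<le> ?P" "0 \<le> ?Q"
    using assms by (intro sum_nonneg; fastforce)+
  have "4 * (a * b) * (?P * ?Q) \<le> (?P + a * b * ?Q)\<^sup>2"
    using zero_le_power2[of "?P - a * b * ?Q"] by (simp add: power2_eq_square algebra_simps)
  also have "\<dots> \<le> ((a + b) * (\<Sum>v\<in>E. c v))\<^sup>2"
    using le nn ab assms(2) by (intro power_mono) auto
  finally show ?thesis .
qed simp

text \<open>On nonnegative numbers \<open>\<mu>\<close> and \<open>\<mu> ^ m\<close> are both
  monotone, hence nonnegatively correlated under the weights \<open>c\<close>. Comparing with the
  weighted mean \<open>t\<close> keeps the argument to a single sum instead of a double sum over
  pairs.\<close>

lemma chebyshev_power_sum:
  fixes c \<mu> :: "'a \<Rightarrow> real"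
  assumes "finite E" "\<And>v. v \<in> E \<Longrightarrow> 0 \<le> c v" "\<And>v. v \<in> E \<Longrightarrow> 0 \<le> \<mu> v"
  shows "(\<Sum>v\<in>E. c v * \<mu> v ^ m) * (\<Sum>v\<in>E. c v * \<mu> v)
    \<le> (\<Sum>v\<in>E. c v * \<mu> v ^ Suc m) * (\<Sum>v\<in>E. c v)"
proof (cases "(\<Sum>v\<in>E. c v) = 0")
  case True
  then have "\<forall>v\<in>E. c v = 0" using assms(1,2) by (simp add: sum_nonneg_eq_0_iff)
  then show ?thesis by simp
next
  case False
  define s where "s = (\<Sum>v\<in>E. c v)"
  have s: "0 < s" using False assms(2) by (simp add: s_def sum_nonneg less_le)
  define t where "t = (\<Sum>v\<in>E. c v * \<mu> v) / s"
  have t: "0 \<le> t" unfolding t_def using s assms by (simp add: sum_nonneg)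
  have st: "(\<Sum>v\<in>E. c v * \<mu> v) = t * s" using s by (simp add: t_def)
  \<comment> \<open>The two differences never have opposite signs. After expansion the two terms
    free of \<open>\<mu>\<close> cancel, because \<open>t\<close> is the mean.\<close>
  have "0 \<le> (\<Sum>v\<in>E. c v * ((\<mu> v ^ m - t ^ m) * (\<mu> v - t)))"
  proof (rule sum_nonneg)
    fix v assume v: "v \<in> E"
    then have "0 \<le> \<mu> v" by (rule assms(3))
    then have "0 \<le> (\<mu> v ^ m - t ^ m) * (\<mu> v - t)"
      using t power_mono[of "\<mu> v" t m] power_mono[of t "\<mu> v" m]
      by (cases "\<mu> v \<le> t") (auto intro: mult_nonpos_nonpos mult_nonneg_nonneg)
    then show "0 \<le> c v * ((\<mu> v ^ m - t ^ m) * (\<mu> v - t))"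
      using assms(2)[OF v] by simp
  qed
  also have "\<dots> = (\<Sum>v\<in>E. c v * \<mu> v ^ Suc m - t * (c v * \<mu> v ^ m)
      - t ^ m * (c v * \<mu> v) + t ^ Suc m * c v)"
    by (intro sum.cong) (auto simp: algebra_simps)
  also have "\<dots> = (\<Sum>v\<in>E. c v * \<mu> v ^ Suc m) - t * (\<Sum>v\<in>E. c v * \<mu> v ^ m)
      - t ^ m * (t * s) + t ^ Suc m * s"
    by (simp only: sum.distrib sum_subtractf sum_distrib_left[symmetric] st s_def)
  finally have "t * (\<Sum>v\<in>E. c v * \<mu> v ^ m) \<le> (\<Sum>v\<in>E. c v * \<mu> v ^ Suc m)" by simp
  from mult_right_mono[OF this less_imp_le[OF s]] show ?thesis
    unfolding st by (simp add: mult_ac flip: s_def)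
qed

text \<open>The nodes \<open>\<mu>\<close> stand for eigenvalues enclosed in the interval from
  \<open>a\<close> to \<open>b\<close>, the weights \<open>c\<close> for squared gradient
  coordinates. The bound \<open>a \<le> b\<close> is a separate assumption since it does not follow
  from the others when \<open>E\<close> is empty.\<close>

locale weighted_spectrum =
  fixes E :: "'a set" and c \<mu> :: "'a \<Rightarrow> real" and a b :: real
  assumes fin: "finite E" and c_nonneg: "v \<in> E \<Longrightarrow> 0 \<le> c v" and a_pos: "0 < a"
    and lower: "v \<in> E \<Longrightarrow> a \<le> \<mu> v" and upper: "v \<in> E \<Longrightarrow> \<mu> v \<le> b" and ab: "a \<le> b"
begin

lemma \<mu>_pos: "v \<in> E \<Longrightarrow> 0 < \<mu> v"
  using lower a_pos by fastforce

lemma term_nonneg: "v \<in> E \<Longrightarrow> 0 \<le> c v * \<mu> v ^ j"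
  using c_nonneg[of v] \<mu>_pos[of v] by simp

lemma power_sum_nonneg: "0 \<le> (\<Sum>v\<in>E. c v * \<mu> v ^ j)"
  by (intro sum_nonneg term_nonneg)

text \<open>The effect of a gradient step of length \<open>t\<close> is quadratic in
  \<open>t\<close>. The sums carry \<open>\<mu> v ^ j / \<mu> v\<close> because the exponent
  \<open>j - 1\<close> is negative for \<open>j = 0\<close>.\<close>

lemma step_expand:
  "(\<Sum>v\<in>E. ((1 - t * \<mu> v)\<^sup>2 * c v) * \<mu> v ^ j / \<mu> v)
    = (\<Sum>v\<in>E. c v * \<mu> v ^ j / \<mu> v) - 2 * t * (\<Sum>v\<in>E. c v * \<mu> v ^ j)
      + t\<^sup>2 * (\<Sum>v\<in>E. c v * \<mu> v ^ Suc j)"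
proof -
  have "(\<Sum>v\<in>E. ((1 - t * \<mu> v)\<^sup>2 * c v) * \<mu> v ^ j / \<mu> v)
    = (\<Sum>v\<in>E. c v * \<mu> v ^ j / \<mu> v - 2 * t * (c v * \<mu> v ^ j) + t\<^sup>2 * (c v * \<mu> v ^ Suc j))"
  proof (intro sum.cong refl)
    fix v assume "v \<in> E"
    then show "(1 - t * \<mu> v)\<^sup>2 * c v * \<mu> v ^ j / \<mu> v
      = c v * \<mu> v ^ j / \<mu> v - 2 * t * (c v * \<mu> v ^ j) + t\<^sup>2 * (c v * \<mu> v ^ Suc j)"
      using \<mu>_pos[of v] by (simp add: field_simps power2_eq_square)
  qed
  also have "\<dots> = (\<Sum>v\<in>E. c v * \<mu> v ^ j / \<mu> v) - 2 * t * (\<Sum>v\<in>E. c v * \<mu> v ^ j)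
      + t\<^sup>2 * (\<Sum>v\<in>E. c v * \<mu> v ^ Suc j)"
    by (simp only: sum.distrib sum_subtractf sum_distrib_left[symmetric])
  finally show ?thesis .
qed

text \<open>This settles the degenerate case of the two contractions, where the denominator of the
  step size vanishes and hence so does the gradient.\<close>

lemma power_sum_eq_0:
  assumes "(\<Sum>v\<in>E. c v * \<mu> v ^ j) = 0"
  shows "\<forall>v\<in>E. c v = 0"
proof
  fix v assume v: "v \<in> E"
  have "c v * \<mu> v ^ j = 0"
    using assms v fin term_nonneg by (simp add: sum_nonneg_eq_0_iff)
  then show "c v = 0" using \<mu>_pos[OF v] by auto
qed

text \<open>The quadratic of \<open>step_expand\<close> with \<open>j = m\<close> is minimal at
  \<open>\<alpha>\<close>, and the relaxed step lowers it by exactly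
  \<open>w * (2 - w) * (?S\<^sup>2 / ?P)\<close>. Kantorovich's inequality with weights
  \<open>c v * \<mu> v ^ m\<close> bounds this decrease below by a multiple of
  \<open>?Q\<close>.\<close>

lemma kantorovich_contraction:
  assumes "0 < w" "w < 2"
    and \<alpha>: "\<alpha> = (\<Sum>v\<in>E. c v * \<mu> v ^ m) / (\<Sum>v\<in>E. c v * \<mu> v ^ Suc m)"
  shows "(\<Sum>v\<in>E. ((1 - w * \<alpha> * \<mu> v)\<^sup>2 * c v) * \<mu> v ^ m / \<mu> v)
    \<le> (1 - w * (2 - w) * (4 * (a * b) / (a + b)\<^sup>2)) * (\<Sum>v\<in>E. c v * \<mu> v ^ m / \<mu> v)"
proof (cases "(\<Sum>v\<in>E. c v * \<mu> v ^ Suc m) = 0")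
  case True
  from power_sum_eq_0[OF this] show ?thesis by simp
next
  case False
  let ?S = "\<Sum>v\<in>E. c v * \<mu> v ^ m" and ?P = "\<Sum>v\<in>E. c v * \<mu> v ^ Suc m"
    and ?Q = "\<Sum>v\<in>E. c v * \<mu> v ^ m / \<mu> v"
  have P: "0 < ?P" using False power_sum_nonneg[of "Suc m"] by linarith
  have "4 * (a * b) * (?P * ?Q) \<le> ((a + b) * ?S)\<^sup>2"
    using kantorovich_sum[of E "\<lambda>v. c v * \<mu> v ^ m" a \<mu> b]
      c_nonneg \<mu>_pos lower upper a_pos
    by (simp add: less_imp_le mult_ac)
  \<comment> \<open>The rearrangement is isolated for real variables, so that simplification does
    not reach into the sums.\<close>
  moreover have scale: "r / h\<^sup>2 * q \<le> s\<^sup>2 / p" if "0 < p" "0 < h" "r * (p * q) \<le> (h * s)\<^sup>2"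
    for p q r s h :: real
    using that by (simp add: field_simps power_mult_distrib)
  ultimately have K: "4 * (a * b) / (a + b)\<^sup>2 * ?Q \<le> ?S\<^sup>2 / ?P"
    using a_pos ab by (intro scale[OF P]) auto
  have "(\<Sum>v\<in>E. ((1 - w * \<alpha> * \<mu> v)\<^sup>2 * c v) * \<mu> v ^ m / \<mu> v)
    = ?Q - 2 * (w * \<alpha>) * ?S + (w * \<alpha>)\<^sup>2 * ?P"
    by (rule step_expand)
  also have "\<dots> = ?Q - w * (2 - w) * (?S\<^sup>2 / ?P)"
    unfolding \<alpha> using P by (simp add: field_simps power2_eq_square)
  also have "\<dots> \<le> ?Q - w * (2 - w) * (4 * (a * b) / (a + b)\<^sup>2 * ?Q)"
    using mult_left_mono[OF K, of "w * (2 - w)"] assms(1,2) by simp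
  finally show ?thesis by (simp only: left_diff_distrib mult_1_left mult.assoc)
qed

text \<open>Here \<open>\<alpha>\<close> need not be the minimizer, but Chebyshev's inequality gives
  \<open>\<alpha> * ?P \<le> ?S\<close>, so the quadratic term costs at most
  \<open>w\<^sup>2 * \<alpha> * ?S\<close>. The remaining decrease
  \<open>w * (2 - w) * \<alpha> * ?S\<close> is controlled by \<open>\<alpha> \<ge> 1 / b\<close>
  and \<open>?S \<ge> a * ?Q\<close>.\<close>

lemma chebyshev_contraction:
  assumes "0 < w" "w < 2"
    and \<alpha>: "\<alpha> = (\<Sum>v\<in>E. c v * \<mu> v ^ m) / (\<Sum>v\<in>E. c v * \<mu> v ^ Suc m)"
  shows "(\<Sum>v\<in>E. ((1 - w * \<alpha> * \<mu> v)\<^sup>2 * c v) / \<mu> v)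
    \<le> (1 - w * (2 - w) * (a / b)) * (\<Sum>v\<in>E. c v / \<mu> v)"
proof (cases "(\<Sum>v\<in>E. c v * \<mu> v ^ Suc m) = 0")
  case True
  from power_sum_eq_0[OF this] show ?thesis by simp
next
  case False
  let ?S = "\<Sum>v\<in>E. c v" and ?P = "\<Sum>v\<in>E. c v * \<mu> v" and ?Q = "\<Sum>v\<in>E. c v / \<mu> v"
  let ?N = "\<Sum>v\<in>E. c v * \<mu> v ^ m" and ?D = "\<Sum>v\<in>E. c v * \<mu> v ^ Suc m"
  have D: "0 < ?D" using False power_sum_nonneg[of "Suc m"] by linarith
  have \<alpha>_nonneg: "0 \<le> \<alpha>" unfolding \<alpha> using D power_sum_nonneg by simp
  have "?D \<le> b * ?N"
    unfolding sum_distrib_left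
  proof (intro sum_mono)
    fix v assume v: "v \<in> E"
    have "c v * \<mu> v ^ m * \<mu> v \<le> c v * \<mu> v ^ m * b"
      using v by (intro mult_left_mono upper term_nonneg)
    then show "c v * \<mu> v ^ Suc m \<le> b * (c v * \<mu> v ^ m)" by (simp add: algebra_simps)
  qed
  then have \<alpha>_lower: "1 / b \<le> \<alpha>"
    unfolding \<alpha> using D a_pos ab by (simp add: field_simps)
  have "?N * ?P \<le> ?D * ?S"
    using chebyshev_power_sum[of E c \<mu> m] fin c_nonneg \<mu>_pos by (simp add: less_imp_le)
  then have \<alpha>P: "\<alpha> * ?P \<le> ?S"
    unfolding \<alpha> using D by (simp add: field_simps)
  have aQ: "a * ?Q \<le> ?S"
    unfolding sum_distrib_left
  proof (intro sum_mono)
    fix v assume v: "v \<in> E"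
    have "a / \<mu> v \<le> 1" using \<mu>_pos[OF v] lower[OF v] by simp
    from mult_left_mono[OF this c_nonneg[OF v]] show "a * (c v / \<mu> v) \<le> c v"
      by (simp add: algebra_simps)
  qed
  have Q: "0 \<le> ?Q" using c_nonneg \<mu>_pos by (intro sum_nonneg) (simp add: less_imp_le)
  have "a / b * ?Q \<le> 1 / b * ?S"
    using aQ a_pos ab by (simp add: field_simps)
  also have "\<dots> \<le> \<alpha> * ?S"
    using \<alpha>_lower c_nonneg by (intro mult_right_mono sum_nonneg) auto
  finally have K: "a / b * ?Q \<le> \<alpha> * ?S" .
  have "(\<Sum>v\<in>E. ((1 - w * \<alpha> * \<mu> v)\<^sup>2 * c v) / \<mu> v)
    = ?Q - 2 * (w * \<alpha>) * ?S + (w * \<alpha>)\<^sup>2 * ?P"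
    using step_expand[of "w * \<alpha>" 0] by simp
  also have "\<dots> = ?Q - 2 * (w * \<alpha>) * ?S + w\<^sup>2 * \<alpha> * (\<alpha> * ?P)"
    by (simp add: power2_eq_square)
  also have "\<dots> \<le> ?Q - 2 * (w * \<alpha>) * ?S + w\<^sup>2 * \<alpha> * ?S"
    using mult_left_mono[OF \<alpha>P, of "w\<^sup>2 * \<alpha>"] \<alpha>_nonneg by simp
  also have "\<dots> = ?Q - w * (2 - w) * (\<alpha> * ?S)"
    by (simp add: algebra_simps power2_eq_square)
  also have "\<dots> \<le> ?Q - w * (2 - w) * (a / b * ?Q)"
    using mult_left_mono[OF K, of "w * (2 - w)"] assms(1,2) by simp
  finally show ?thesis by (simp only: left_diff_distrib mult_1_left mult.assoc)
qed

lemma power_sum_compare: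
  "a ^ m * (\<Sum>v\<in>E. c v / \<mu> v) \<le> (\<Sum>v\<in>E. c v * \<mu> v ^ m / \<mu> v)"
  "(\<Sum>v\<in>E. c v * \<mu> v ^ m / \<mu> v) \<le> b ^ m * (\<Sum>v\<in>E. c v / \<mu> v)"
proof -
  have nn: "0 \<le> c v / \<mu> v" if "v \<in> E" for v
    using c_nonneg[OF that] \<mu>_pos[OF that] by simp
  show "a ^ m * (\<Sum>v\<in>E. c v / \<mu> v) \<le> (\<Sum>v\<in>E. c v * \<mu> v ^ m / \<mu> v)"
    unfolding sum_distrib_left
  proof (intro sum_mono)
    fix v assume v: "v \<in> E"
    show "a ^ m * (c v / \<mu> v) \<le> c v * \<mu> v ^ m / \<mu> v"
      using mult_right_mono[OF power_mono[OF lower[OF v] less_imp_le[OF a_pos], of m] nn[OF v]]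
      by (simp add: algebra_simps)
  qed
  show "(\<Sum>v\<in>E. c v * \<mu> v ^ m / \<mu> v) \<le> b ^ m * (\<Sum>v\<in>E. c v / \<mu> v)"
    unfolding sum_distrib_left
  proof (intro sum_mono)
    fix v assume v: "v \<in> E"
    show "c v * \<mu> v ^ m / \<mu> v \<le> b ^ m * (c v / \<mu> v)"
      using mult_right_mono[OF power_mono[OF upper[OF v] less_imp_le[OF \<mu>_pos[OF v]], of m] nn[OF v]]
      by (simp add: algebra_simps)
  qed
qed

end

section \<open>Orthonormal eigenbases\<close>

text \<open>The quadratic form of \<open>A\<close> attains a maximum \<open>M\<close> on the compact
  unit sphere of \<open>S\<close>. Invariance puts the residual \<open>w = M v - A v\<close> into
  \<open>S\<close>, and a nonzero residual would be a direction contradicting maximality.\<close>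

lemma symmetric_eigenvector_in_invariant_subspace:
  fixes A :: "real^'n^'n"
  assumes sym: "transpose A = A" and S: "subspace S" and inv: "\<And>x. x \<in> S \<Longrightarrow> A *v x \<in> S"
    and ne: "S \<noteq> {0}"
  shows "\<exists>v\<in>S. norm v = 1 \<and> A *v v = (v \<bullet> (A *v v)) *\<^sub>R v"
proof -
  let ?T = "sphere 0 1 \<inter> S"
  obtain u where u: "u \<in> S" "u \<noteq> 0" using ne S subspace_0 by blast
  then have "u /\<^sub>R norm u \<in> ?T" using S by (simp add: subspace_scale)
  moreover have "compact ?T" using S by (intro compact_Int_closed closed_subspace) auto
  moreover have "continuous_on ?T (\<lambda>x. x \<bullet> (A *v x))"
    by (intro continuous_intros linear_continuous_on matrix_vector_mul_bounded_linear)
  ultimately obtain v where v: "v \<in> ?T"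
    and vmax: "\<And>x. x \<in> ?T \<Longrightarrow> x \<bullet> (A *v x) \<le> v \<bullet> (A *v v)"
    using continuous_attains_sup[of ?T "\<lambda>x. x \<bullet> (A *v x)"] by blast
  define M where "M = v \<bullet> (A *v v)"
  have vS: "v \<in> S" and vv: "v \<bullet> v = 1" and nv: "norm v = 1"
    using v by (auto simp: norm_eq_1)
  define q where "q x = M * (x \<bullet> x) - x \<bullet> (A *v x)" for x
  have q: "0 \<le> q x" if x: "x \<in> S" for x
  proof (cases "x = 0")
    case False
    let ?y = "x /\<^sub>R norm x"
    have "?y \<bullet> (A *v ?y) \<le> M"
      unfolding M_def using False x S by (intro vmax) (simp add: subspace_scale)
    then have "x \<bullet> (A *v x) / (x \<bullet> x) \<le> M"
      by (simp add: matrix_vector_mult_scaleR dot_square_norm power2_eq_square divide_simps)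
    then show ?thesis using False by (simp add: q_def field_simps)
  qed (simp add: q_def)
  define w where "w = M *\<^sub>R v - A *v v"
  have w: "w \<in> S" using S inv vS by (simp add: w_def subspace_diff subspace_scale)
  have expand: "q (v + t *\<^sub>R w) = 2 * t * (w \<bullet> w) + t\<^sup>2 * q w" for t
  proof -
    have 1: "v \<bullet> (A *v w) = w \<bullet> (A *v v)"
      using sym_inner_commute[OF sym, of v w] by (simp add: inner_commute)
    have 2: "M * (w \<bullet> v) - w \<bullet> (A *v v) = w \<bullet> w"
      by (simp add: w_def inner_diff_right)
    have "q (v + t *\<^sub>R w) = (M * (v \<bullet> v) - v \<bullet> (A *v v))
      + 2 * t * (M * (w \<bullet> v) - w \<bullet> (A *v v)) + t\<^sup>2 * q w"
      unfolding q_def using 1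
      by (simp add: matrix_vector_right_distrib matrix_vector_mult_scaleR inner_add_left
          inner_add_right inner_commute[of v w] power2_eq_square algebra_simps)
    moreover have "M * (v \<bullet> v) - v \<bullet> (A *v v) = 0" by (simp add: vv M_def)
    ultimately show ?thesis by (simp only: 2 add_0)
  qed
  have "w \<bullet> w = 0"
  proof (rule ccontr)
    assume "w \<bullet> w \<noteq> 0"
    then have p: "0 < w \<bullet> w" by simp
    \<comment> \<open>With this choice \<open>t * q w\<close> stays below
      \<open>w \<bullet> w\<close>, so \<open>q\<close> would be negative at \<open>v - t w\<close>.
      The summand \<open>1\<close> keeps the denominator positive.\<close>
    define t where "t = (w \<bullet> w) / (q w + 1)"
    have t: "0 < t" using p q[OF w] by (simp add: t_def)
    have tq: "t * (q w + 1) = w \<bullet> w" using q[OF w] by (simp add: t_def)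
    have "v + (- t) *\<^sub>R w \<in> S" using S vS w by (intro subspace_add subspace_scale)
    then have "0 \<le> t * (t * q w - 2 * (w \<bullet> w))"
      using q[of "v + (- t) *\<^sub>R w"] expand[of "- t"] by (simp add: algebra_simps power2_eq_square)
    then have "0 \<le> t * q w - 2 * (w \<bullet> w)" using t by (simp add: zero_le_mult_iff)
    then show False using tq p t by (simp add: algebra_simps)
  qed
  then have "A *v v = M *\<^sub>R v" by (simp add: w_def)
  then show ?thesis using vS nv by (auto simp: M_def)
qed

text \<open>Completeness is expressed by a trivial orthogonal complement, and eigenvalues by
  Rayleigh quotients, so that no separate eigenvalue function is carried along.\<close>

definition orthonormal_eigenbasis :: "real^'n^'n \<Rightarrow> (real^'n) set \<Rightarrow> bool" where
  "orthonormal_eigenbasis A E \<longleftrightarrow> finite E \<and> pairwise orthogonal E \<and>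
     (\<forall>v\<in>E. norm v = 1 \<and> A *v v = (v \<bullet> (A *v v)) *\<^sub>R v) \<and>
     (\<forall>x. (\<forall>v\<in>E. v \<bullet> x = 0) \<longrightarrow> x = 0)"

text \<open>An orthonormal set of eigenvectors of greatest cardinality exists because the dimension
  bounds its size. Its orthogonal complement is invariant by symmetry of \<open>A\<close>, so a
  nonzero complement would supply one more eigenvector.\<close>

lemma exists_orthonormal_eigenbasis:
  fixes A :: "real^'n^'n"
  assumes sym: "transpose A = A"
  shows "\<exists>E. orthonormal_eigenbasis A E"
proof -
  define P where "P E \<longleftrightarrow> pairwise orthogonal E \<and>
     (\<forall>v\<in>E. norm v = 1 \<and> A *v v = (v \<bullet> (A *v v)) *\<^sub>R v)" for E
  have card: "finite E \<and> card E \<le> DIM(real^'n)" if "P E" for E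
  proof -
    have "independent E"
      using that by (intro pairwise_orthogonal_independent) (auto simp: P_def)
    then show ?thesis using independent_bound by blast
  qed
  have "P {}" by (simp add: P_def)
  moreover have "\<forall>E. P E \<longrightarrow> card E < Suc DIM(real^'n)"
    using card by (simp add: less_Suc_eq_le)
  ultimately obtain E where E: "P E" and Emax: "\<And>F. P F \<Longrightarrow> card F \<le> card E"
    using ex_has_greatest_nat[of P "{}" card] by blast
  let ?S = "{x. \<forall>v\<in>E. v \<bullet> x = 0}"
  have "?S = {0}"
  proof (rule ccontr)
    assume ne: "?S \<noteq> {0}"
    have inv: "A *v x \<in> ?S" if "x \<in> ?S" for x
    proof safe
      fix v assume v: "v \<in> E"
      have "v \<bullet> (A *v x) = (A *v v) \<bullet> x" by (rule sym_inner_commute[OF sym])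
      also have "\<dots> = ((v \<bullet> (A *v v)) *\<^sub>R v) \<bullet> x" using E v by (metis P_def)
      also have "\<dots> = 0" using that v by simp
      finally show "v \<bullet> (A *v x) = 0" .
    qed
    have "subspace ?S" by (auto simp: subspace_def inner_add_right)
    from symmetric_eigenvector_in_invariant_subspace[OF sym this inv ne]
    obtain u where u: "u \<in> ?S" "norm u = 1" "A *v u = (u \<bullet> (A *v u)) *\<^sub>R u"
      by blast
    have "P (insert u E)"
      using E u by (auto simp: P_def pairwise_insert orthogonal_def inner_commute)
    moreover have "u \<notin> E" using u by auto
    ultimately show False using Emax[of "insert u E"] card[OF E] by simp
  qed
  then have "orthonormal_eigenbasis A E"
    using E card[OF E] by (auto simp: orthonormal_eigenbasis_def P_def)
  then show ?thesis ..
qed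

locale posdef_eigenbasis =
  fixes A :: "real^'n^'n" and E :: "(real^'n) set"
  assumes posdef: "sym_posdef A" and basis: "orthonormal_eigenbasis A E"
begin

definition \<mu> :: "real^'n \<Rightarrow> real" where
  "\<mu> v = v \<bullet> (A *v v)"

lemma sym: "transpose A = A"
  using posdef by (simp add: sym_posdef_def)

lemma fin: "finite E"
  using basis by (simp add: orthonormal_eigenbasis_def)

lemma norm_E: "v \<in> E \<Longrightarrow> norm v = 1"
  using basis by (simp add: orthonormal_eigenbasis_def)

lemma eigen: "v \<in> E \<Longrightarrow> A *v v = \<mu> v *\<^sub>R v"
  using basis by (simp add: orthonormal_eigenbasis_def \<mu>_def)

lemma \<mu>_pos: "v \<in> E \<Longrightarrow> 0 < \<mu> v"
  using posdef norm_E[of v] by (cases "v = 0") (auto simp: sym_posdef_def \<mu>_def)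

lemma inner_E: "u \<in> E \<Longrightarrow> v \<in> E \<Longrightarrow> u \<bullet> v = (if u = v then 1 else 0)"
  using basis
  by (auto simp: orthonormal_eigenbasis_def pairwise_def orthogonal_def norm_eq_1)

lemma inner_sum_E:
  assumes "u \<in> E"
  shows "u \<bullet> (\<Sum>v\<in>E. f v *\<^sub>R v) = f u"
proof -
  have "u \<bullet> (\<Sum>v\<in>E. f v *\<^sub>R v) = (\<Sum>v\<in>E. if u = v then f v else 0)"
    using assms by (auto simp: inner_sum_right inner_E intro: sum.cong)
  then show ?thesis using assms fin by simp
qed

lemma eqI:
  assumes "\<And>v. v \<in> E \<Longrightarrow> v \<bullet> x = v \<bullet> y"
  shows "x = y"
proof -
  have "\<forall>v\<in>E. v \<bullet> (x - y) = 0" using assms by (simp add: inner_diff_right)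
  then have "x - y = 0" using basis by (auto simp: orthonormal_eigenbasis_def)
  then show ?thesis by simp
qed

lemma expand: "x = (\<Sum>v\<in>E. (v \<bullet> x) *\<^sub>R v)"
  by (rule eqI) (simp add: inner_sum_E)

lemma inner_expand: "x \<bullet> y = (\<Sum>v\<in>E. (v \<bullet> x) * (v \<bullet> y))"
  by (subst expand[of x]) (simp add: inner_sum_left)

lemma inner_A: "v \<in> E \<Longrightarrow> v \<bullet> (A *v x) = \<mu> v * (v \<bullet> x)"
  using sym_inner_commute[OF sym, of v x] eigen by simp

lemma E_nonempty: "E \<noteq> {}"
  \<comment> \<open>If \<open>E\<close> were empty, completeness would make every vector zero, yet
    the vector with all components \<open>1\<close> is not.\<close>
  using basis zero_neq_one[where 'a = "real^'n"] by (auto simp: orthonormal_eigenbasis_def)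

text \<open>An eigenvector has a nonzero coordinate along some basis vector \<open>v\<close>, and
  comparing that coordinate on both sides of the eigenvalue equation identifies its eigenvalue as
  \<open>\<mu> v\<close>.\<close>

lemma eigenvalues_eq: "eigenvalues A = \<mu> ` E"
proof safe
  fix r assume "r \<in> eigenvalues A"
  then obtain x where x: "x \<noteq> 0" "A *v x = r *\<^sub>R x" by (auto simp: eigenvalues_def)
  then obtain v where v: "v \<in> E" "v \<bullet> x \<noteq> 0" using eqI[of x 0] by auto
  have "\<mu> v * (v \<bullet> x) = v \<bullet> (A *v x)" by (simp add: inner_A v)
  also have "\<dots> = r * (v \<bullet> x)" by (simp add: x)
  finally show "r \<in> \<mu> ` E" using v by auto
next
  fix v assume v: "v \<in> E"
  then have "v \<noteq> 0" using norm_E by fastforce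
  then show "\<mu> v \<in> eigenvalues A" using eigen[OF v] by (auto simp: eigenvalues_def)
qed

lemma eigenvalue_bounds:
  shows "0 < min_eigenvalue A" "min_eigenvalue A \<le> max_eigenvalue A"
    and "v \<in> E \<Longrightarrow> min_eigenvalue A \<le> \<mu> v" "v \<in> E \<Longrightarrow> \<mu> v \<le> max_eigenvalue A"
proof -
  have f: "finite (\<mu> ` E)" "\<mu> ` E \<noteq> {}" using fin E_nonempty by auto
  show "0 < min_eigenvalue A"
    using f \<mu>_pos by (auto simp: min_eigenvalue_def eigenvalues_eq)
  show "min_eigenvalue A \<le> max_eigenvalue A"
    using f by (simp add: min_eigenvalue_def max_eigenvalue_def eigenvalues_eq del: image_is_empty)
  show "v \<in> E \<Longrightarrow> min_eigenvalue A \<le> \<mu> v" "v \<in> E \<Longrightarrow> \<mu> v \<le> max_eigenvalue A"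
    using f by (auto simp: min_eigenvalue_def max_eigenvalue_def eigenvalues_eq)
qed

section \<open>Half-integer powers\<close>

lemma inner_mat_pow: "v \<in> E \<Longrightarrow> v \<bullet> (mat_pow A k *v x) = \<mu> v ^ k * (v \<bullet> x)"
  by (induction k) (simp_all add: mat_pow_def inner_A flip: matrix_vector_mul_assoc)

text \<open>From \<open>B (B v) = s\<^sup>2 v\<close> the residual \<open>z = B v - s v\<close>
  satisfies \<open>B z = - s z\<close>. A positive definite matrix has no negative eigenvalue, so
  \<open>z = 0\<close>. This fixes a positive definite root on the whole basis and yields
  uniqueness.\<close>

lemma square_root_eigen:
  assumes B: "sym_posdef B" "B ** B = A" and v: "v \<in> E"
  shows "B *v v = sqrt (\<mu> v) *\<^sub>R v"
proof -
  define s where "s = sqrt (\<mu> v)"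
  have s: "0 < s" "s * s = \<mu> v" using \<mu>_pos[OF v] by (simp_all add: s_def)
  define z where "z = B *v v - s *\<^sub>R v"
  have "B *v z = - s *\<^sub>R z"
  proof -
    have "B *v (B *v v) = (s * s) *\<^sub>R v"
      using B(2) eigen[OF v] s(2) by (metis matrix_vector_mul_assoc)
    then show ?thesis
      by (simp add: z_def matrix_vector_mult_diff_distrib matrix_vector_mult_scaleR
          scaleR_diff_right)
  qed
  then have "z \<bullet> (B *v z) = - s * (z \<bullet> z)" by simp
  then have "\<not> 0 < z \<bullet> (B *v z)"
    using s(1) by (simp add: not_less)
  then have "z = 0" using B(1) by (auto simp: sym_posdef_def)
  then show ?thesis by (simp add: z_def s_def)
qed

lemma exists_square_root: "\<exists>B. sym_posdef B \<and> B ** B = A"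
proof -
  \<comment> \<open>The root scales each eigencoordinate by the square root of its
    eigenvalue.\<close>
  define f where "f x = (\<Sum>v\<in>E. (sqrt (\<mu> v) * (v \<bullet> x)) *\<^sub>R v)" for x
  have "linear f"
    by (rule linearI)
      (simp_all add: f_def inner_add_right algebra_simps sum.distrib scaleR_sum_right)
  define B where "B = matrix f"
  have B: "B *v x = f x" for x using \<open>linear f\<close> by (simp add: B_def matrix_works)
  have vB: "v \<bullet> (B *v x) = sqrt (\<mu> v) * (v \<bullet> x)" if "v \<in> E" for v x
    using that by (simp add: B f_def inner_sum_E)
  have "x \<bullet> (transpose B *v y) = x \<bullet> (B *v y)" for x y
  proof -
    have "x \<bullet> (transpose B *v y) = (B *v x) \<bullet> y"
      by (metis dot_lmul_matrix inner_commute transpose_matrix_vector)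
    also have "\<dots> = x \<bullet> (B *v y)"
      by (simp add: inner_expand[of "B *v x"] inner_expand[of x] vB mult_ac)
    finally show ?thesis .
  qed
  then have "transpose B = B" by (metis matrix_eq vector_eq_ldot)
  moreover have "0 < x \<bullet> (B *v x)" if "x \<noteq> 0" for x
  proof -
    have "\<exists>u\<in>E. u \<bullet> x \<noteq> 0"
    proof (rule ccontr)
      assume "\<not> ?thesis"
      then have "x = 0" by (intro eqI) auto
      with that show False by simp
    qed
    then obtain u where u: "u \<in> E" "u \<bullet> x \<noteq> 0" by blast
    have "x \<bullet> (B *v x) = (\<Sum>v\<in>E. sqrt (\<mu> v) * (v \<bullet> x)\<^sup>2)"
      by (simp add: inner_expand[of x] vB power2_eq_square mult_ac)
    also have "0 < \<dots>"
      using u fin \<mu>_pos by (intro sum_pos2[of E u]) (auto simp: less_imp_le)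
    finally show ?thesis .
  qed
  moreover have "B ** B = A"
    unfolding matrix_eq
  proof
    fix x show "B ** B *v x = A *v x"
      by (rule eqI) (simp add: vB inner_A \<mu>_pos less_imp_le flip: matrix_vector_mul_assoc)
  qed
  ultimately show ?thesis unfolding sym_posdef_def by blast
qed

lemma mat_sqrt: "sym_posdef (mat_sqrt A)" "mat_sqrt A ** mat_sqrt A = A"
proof -
  obtain B where B: "sym_posdef B" "B ** B = A" using exists_square_root by blast
  have "C = B" if C: "sym_posdef C \<and> C ** C = A" for C
    unfolding matrix_eq
  proof
    fix x
    have "v \<bullet> (C *v x) = v \<bullet> (B *v x)" if v: "v \<in> E" for v
      using sym_inner_commute[of C v x] sym_inner_commute[of B v x] C B v
      by (simp add: sym_posdef_def square_root_eigen)
    then show "C *v x = B *v x" by (rule eqI)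
  qed
  then have "\<exists>!B. sym_posdef B \<and> B ** B = A" using B by blast
  from theI'[OF this] show "sym_posdef (mat_sqrt A)" "mat_sqrt A ** mat_sqrt A = A"
    by (simp_all add: mat_sqrt_def)
qed

text \<open>Writing the exponent as \<open>m / 2\<close> covers integer and half-integer powers by
  one formula; the parity of \<open>m\<close> decides which branch of \<open>mat_hpow\<close>
  applies.\<close>

lemma inner_mat_hpow:
  assumes v: "v \<in> E"
  shows "v \<bullet> (mat_hpow A (real m / 2) *v x) = sqrt (\<mu> v) ^ m * (v \<bullet> x)"
proof (cases "even m")
  case True
  then obtain k where k: "m = 2 * k" by blast
  have "mat_hpow A (real m / 2) = mat_pow A k" by (simp add: k mat_hpow_def)
  then show ?thesis
    using v \<mu>_pos[OF v] by (simp add: inner_mat_pow k power_mult)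
next
  case False
  then obtain k where k: "m = 2 * k + 1" by (elim oddE)
  have fl: "\<lfloor>real m / 2\<rfloor> = int k" by (simp add: k floor_eq_iff)
  have "real m / 2 \<notin> \<nat>"
  proof
    assume "real m / 2 \<in> \<nat>"
    then obtain j where "real m / 2 = real j" by (auto elim: Nats_cases)
    then have "real m = real (2 * j)" by simp
    then have "m = 2 * j" by (simp only: of_nat_eq_iff)
    then show False using k by presburger
  qed
  then have "mat_hpow A (real m / 2) = mat_pow A k ** mat_sqrt A"
    by (simp add: mat_hpow_def fl)
  moreover have "v \<bullet> (mat_sqrt A *v x) = sqrt (\<mu> v) * (v \<bullet> x)"
    using sym_inner_commute[of "mat_sqrt A" v x] mat_sqrt v
    by (simp add: sym_posdef_def square_root_eigen)
  ultimately show ?thesis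
    using v \<mu>_pos[OF v] by (simp add: inner_mat_pow k power_mult flip: matrix_vector_mul_assoc)
qed

section \<open>The iteration in eigencoordinates\<close>

text \<open>The gap is half the energy of the error \<open>x - s\<close>, and the gradient is
  \<open>A\<close> applied to this error, so each error coordinate is a gradient coordinate divided
  by \<open>\<mu> v\<close>.\<close>

lemma quad_gap:
  "quad_obj A b x - opt_value A b = (1/2) * (\<Sum>v\<in>E. (v \<bullet> quad_grad A b x)\<^sup>2 / \<mu> v)"
proof -
  define s where "s = minimizer A b"
  have s: "A *v s = b" using mul_minimizer[OF posdef] by (simp add: s_def)
  have "quad_obj A b x - opt_value A b = (1/2) * ((x - s) \<bullet> (A *v (x - s)))"
    using sym_inner_commute[OF sym, of s x] s
    by (simp add: opt_value_def quad_obj_def matrix_vector_mult_diff_distrib inner_diff_left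
        inner_diff_right inner_commute flip: s_def)
  also have "(x - s) \<bullet> (A *v (x - s)) = (\<Sum>v\<in>E. (v \<bullet> quad_grad A b x)\<^sup>2 / \<mu> v)"
    unfolding inner_expand[of "x - s"]
  proof (intro sum.cong refl)
    fix v assume v: "v \<in> E"
    have "quad_grad A b x = A *v (x - s)"
      by (simp add: quad_grad_def s matrix_vector_mult_diff_distrib)
    then show "v \<bullet> (x - s) * (v \<bullet> (A *v (x - s))) = (v \<bullet> quad_grad A b x)\<^sup>2 / \<mu> v"
      using \<mu>_pos[OF v] v by (simp add: inner_A power2_eq_square)
  qed
  finally show ?thesis .
qed

text \<open>For a vanishing gradient both sides are \<open>0\<close>, as \<open>0 / 0 = 0\<close>.\<close>

lemma mgd_step_size_eq:
  "mgd_step_size A b (real m / 2) x =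
    (\<Sum>v\<in>E. (v \<bullet> quad_grad A b x)\<^sup>2 * \<mu> v ^ m) / (\<Sum>v\<in>E. (v \<bullet> quad_grad A b x)\<^sup>2 * \<mu> v ^ Suc m)"
proof -
  define g where "g = quad_grad A b x"
  define y where "y = mat_hpow A (real m / 2) *v g"
  have sq: "(v \<bullet> y) * (v \<bullet> y) = (v \<bullet> g)\<^sup>2 * \<mu> v ^ m" if v: "v \<in> E" for v
  proof -
    have "(v \<bullet> y) * (v \<bullet> y) = (v \<bullet> g)\<^sup>2 * (sqrt (\<mu> v) ^ m)\<^sup>2"
      using v by (simp add: y_def inner_mat_hpow power2_eq_square)
    also have "(sqrt (\<mu> v) ^ m)\<^sup>2 = ((sqrt (\<mu> v))\<^sup>2) ^ m"
      by (simp only: power_mult[symmetric] mult.commute)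
    finally show ?thesis using \<mu>_pos[OF v] by simp
  qed
  have "y \<bullet> y = (\<Sum>v\<in>E. (v \<bullet> g)\<^sup>2 * \<mu> v ^ m)"
    by (simp add: inner_expand[of y] sq)
  moreover have "y \<bullet> (A *v y) = (\<Sum>v\<in>E. (v \<bullet> g)\<^sup>2 * \<mu> v ^ Suc m)"
    unfolding inner_expand[of y]
  proof (intro sum.cong refl)
    fix v assume v: "v \<in> E"
    have "v \<bullet> y * (v \<bullet> (A *v y)) = \<mu> v * ((v \<bullet> y) * (v \<bullet> y))"
      using v by (simp add: inner_A)
    then show "v \<bullet> y * (v \<bullet> (A *v y)) = (v \<bullet> g)\<^sup>2 * \<mu> v ^ Suc m"
      using sq[OF v] by simp
  qed
  ultimately show ?thesis
    by (simp add: mgd_step_size_def Let_def flip: g_def y_def)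
qed

text \<open>The gradient is affine in \<open>x\<close>, so a step of length \<open>t\<close> applies
  \<open>I - t A\<close> to it.\<close>

lemma inner_quad_grad_step:
  assumes "v \<in> E"
  shows "v \<bullet> quad_grad A b (x - t *\<^sub>R quad_grad A b x) = (1 - t * \<mu> v) * (v \<bullet> quad_grad A b x)"
proof -
  define g where "g = quad_grad A b x"
  have "quad_grad A b (x - t *\<^sub>R g) = g - t *\<^sub>R (A *v g)"
    by (simp add: g_def quad_grad_def[of A b] matrix_vector_mult_diff_distrib
        matrix_vector_mult_scaleR algebra_simps)
  then have "v \<bullet> quad_grad A b (x - t *\<^sub>R g) = (1 - t * \<mu> v) * (v \<bullet> g)"
    using assms by (simp add: inner_diff_right inner_A left_diff_distrib)
  then show ?thesis by (simp add: g_def)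
qed

end

section \<open>Exponential decay and iteration counts\<close>

text \<open>Each contraction factor is bounded by \<open>1 - q \<le> exp (- q)\<close>, which
  produces the logarithm in the iteration counts.\<close>

lemma contraction_imp_exp_decay:
  fixes D :: "nat \<Rightarrow> real"
  assumes "\<And>k. D (Suc k) \<le> (1 - q) * D k" "\<And>k. 0 \<le> D k"
  shows "D k \<le> exp (- (q * real k)) * D 0"
proof (induction k)
  case (Suc k)
  have "D (Suc k) \<le> (1 - q) * D k" by (rule assms)
  also have "\<dots> \<le> exp (- q) * D k"
    using exp_ge_add_one_self[of "- q"] assms(2) by (intro mult_right_mono) auto
  also have "\<dots> \<le> exp (- q) * (exp (- (q * real k)) * D 0)"
    using Suc by (intro mult_left_mono) auto
  also have "\<dots> = exp (- (q * real (Suc k))) * D 0"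
    by (simp add: exp_add[symmetric] mult.assoc[symmetric] algebra_simps)
  finally show ?case .
qed simp

text \<open>The disjunct \<open>r = 0\<close> realizes the reading of the logarithm of zero as minus
  infinity.\<close>

lemma exp_decay_le:
  fixes q r :: real
  assumes "0 < q" "0 < \<epsilon>" "0 \<le> r" and K: "r = 0 \<or> real K > ln (r / \<epsilon>) / q"
  shows "exp (- (q * real K)) * r \<le> \<epsilon>"
proof (cases "r = 0")
  case False
  then have r: "0 < r" using assms(3) by simp
  have "ln (r / \<epsilon>) < q * real K" using K False assms(1) by (simp add: field_simps)
  then have "exp (ln (r / \<epsilon>)) < exp (q * real K)" by simp
  then have "r < \<epsilon> * exp (q * real K)" using r assms(2) by (simp add: field_simps)
  then show ?thesis by (simp add: exp_minus field_simps)
qed (use assms(2) in simp)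


theorem theorem13:
  fixes A :: "real^'n^'n" and b x0 :: "real^'n"
    and l \<omega> \<epsilon> \<epsilon>' :: real
  assumes "sym_posdef A"
    and "l \<in> {real m / 2 | m :: nat. True}"
    and "0 < \<omega>" and "\<omega> < 2"
    and "0 < \<epsilon>" and "0 < \<epsilon>'"
  shows
    "(\<forall>K::nat.
        quad_obj A b x0 = opt_value A b \<or>
        real K > cond_number A / (\<omega> * (2 - \<omega>))
                   * ln ((quad_obj A b x0 - opt_value A b) / \<epsilon>)
        \<longrightarrow> quad_obj A b (relaxed_mgd A b l \<omega> x0 K) - opt_value A b \<le> \<epsilon>) \<and>
     (\<forall>K'::nat.
        quad_obj A b x0 = opt_value A b \<or>
        real K' > 1 / (\<omega> * (2 - \<omega>)) * ((cond_number A + 1)\<^sup>2 / (4 * cond_number A))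
                   * ln (cond_number A powr (2 * l) * (quad_obj A b x0 - opt_value A b) / \<epsilon>')
        \<longrightarrow> quad_obj A b (relaxed_mgd A b l \<omega> x0 K') - opt_value A b \<le> \<epsilon>')"
proof -
  from assms(2) obtain m :: nat where l: "l = real m / 2" by auto
  from assms(1) obtain E where E: "orthonormal_eigenbasis A E"
    using exists_orthonormal_eigenbasis by (auto simp: sym_posdef_def)
  interpret posdef_eigenbasis A E using assms(1) E by unfold_locales
  define a where "a = min_eigenvalue A"
  define d where "d = max_eigenvalue A"
  have a: "0 < a" and ad: "a \<le> d"
    and bnd: "\<And>v. v \<in> E \<Longrightarrow> a \<le> \<mu> v" "\<And>v. v \<in> E \<Longrightarrow> \<mu> v \<le> d"
    using eigenvalue_bounds by (auto simp: a_def d_def)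
  define \<kappa> where "\<kappa> = cond_number A"
  have \<kappa>: "\<kappa> = d / a" by (simp add: \<kappa>_def cond_number_def a_def d_def)
  have \<kappa>_pos: "0 < \<kappa>" using a ad by (simp add: \<kappa>)
  define X where "X k = relaxed_mgd A b l \<omega> x0 k" for k
  define c where "c k v = (v \<bullet> quad_grad A b (X k))\<^sup>2" for k v
  \<comment> \<open>Only the weights depend on the iteration; one interpretation serves every
    \<open>k\<close>.\<close>
  interpret W: weighted_spectrum E "c k" \<mu> a d for k
    using fin a ad bnd by unfold_locales (auto simp: c_def)
  define \<alpha> where "\<alpha> k = (\<Sum>v\<in>E. c k v * \<mu> v ^ m) / (\<Sum>v\<in>E. c k v * \<mu> v ^ Suc m)" for k
  have c_Suc: "c (Suc k) v = (1 - \<omega> * \<alpha> k * \<mu> v)\<^sup>2 * c k v" if "v \<in> E" for k v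
  proof -
    have "mgd_step_size A b l (X k) = \<alpha> k"
      by (simp only: l mgd_step_size_eq \<alpha>_def c_def)
    then have "X (Suc k) = X k - (\<omega> * \<alpha> k) *\<^sub>R quad_grad A b (X k)"
      by (simp add: X_def Let_def)
    then show ?thesis using that by (simp add: c_def inner_quad_grad_step power_mult_distrib)
  qed
  define \<Phi> where "\<Phi> j k = (\<Sum>v\<in>E. c k v * \<mu> v ^ j / \<mu> v)" for j k
  have \<Phi>_nonneg: "0 \<le> \<Phi> j k" for j k
    unfolding \<Phi>_def by (intro sum_nonneg) (auto simp: c_def \<mu>_pos less_imp_le)
  have gap: "quad_obj A b (X k) - opt_value A b = \<Phi> 0 k / 2" for k
    by (simp add: quad_gap \<Phi>_def c_def)
  have X0: "X 0 = x0" by (simp add: X_def)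
  have gap0: "quad_obj A b x0 - opt_value A b = \<Phi> 0 0 / 2" using gap[of 0] by (simp add: X0)
  define p where "p = \<omega> * (2 - \<omega>)"
  have p: "0 < p" using assms(3,4) by (simp add: p_def)
  have step: "\<Phi> 0 (Suc k) \<le> (1 - p * (a / d)) * \<Phi> 0 k"
    and step_m: "\<Phi> m (Suc k) \<le> (1 - p * (4 * (a * d) / (a + d)\<^sup>2)) * \<Phi> m k" for k
    using W.chebyshev_contraction[OF assms(3,4) \<alpha>_def] W.kantorovich_contraction[OF assms(3,4) \<alpha>_def]
    by (simp_all add: \<Phi>_def c_Suc p_def)
  have part1: "quad_obj A b (X K) - opt_value A b \<le> \<epsilon>"
    if K: "quad_obj A b x0 = opt_value A b \<or>
      real K > \<kappa> / (\<omega> * (2 - \<omega>)) * ln ((quad_obj A b x0 - opt_value A b) / \<epsilon>)" for K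
  proof -
    define q where "q = p * (a / d)"
    have q: "0 < q" using p a ad by (simp add: q_def)
    \<comment> \<open>The prefactor of the logarithm is the reciprocal of the decay rate.\<close>
    have q': "\<kappa> / p = 1 / q" using a ad by (simp add: \<kappa> q_def)
    have "\<Phi> 0 K / 2 \<le> exp (- (q * real K)) * (\<Phi> 0 0 / 2)"
      using contraction_imp_exp_decay[of "\<Phi> 0" q K] step \<Phi>_nonneg by (simp add: q_def)
    also have "\<dots> \<le> \<epsilon>"
      using K gap0 q' by (intro exp_decay_le q assms(5)) (auto simp: \<Phi>_nonneg p_def[symmetric])
    finally show ?thesis by (simp only: gap)
  qed
  have part2: "quad_obj A b (X K) - opt_value A b \<le> \<epsilon>'"
    if K: "quad_obj A b x0 = opt_value A b \<or>
      real K > 1 / (\<omega> * (2 - \<omega>)) * ((\<kappa> + 1)\<^sup>2 / (4 * \<kappa>))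
        * ln (\<kappa> powr (2 * l) * (quad_obj A b x0 - opt_value A b) / \<epsilon>')" for K
  proof -
    define q where "q = p * (4 * (a * d) / (a + d)\<^sup>2)"
    have q: "0 < q" using p a ad by (simp add: q_def)
    \<comment> \<open>Numerator and denominator are divided by \<open>a\<^sup>2\<close>.\<close>
    have "4 * (a * d) / (a + d)\<^sup>2 = 4 * \<kappa> / (\<kappa> + 1)\<^sup>2"
      using a ad by (simp add: \<kappa> field_simps power2_eq_square)
    then have q': "1 / p * ((\<kappa> + 1)\<^sup>2 / (4 * \<kappa>)) = 1 / q" by (simp add: q_def)
    have powr: "\<kappa> powr (2 * l) = \<kappa> ^ m" using \<kappa>_pos by (simp add: l powr_realpow)
    have "a ^ m * \<Phi> 0 K \<le> \<Phi> m K"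
      using W.power_sum_compare(1)[of m K] by (simp add: \<Phi>_def)
    also have "\<dots> \<le> exp (- (q * real K)) * \<Phi> m 0"
      using contraction_imp_exp_decay[of "\<Phi> m" q K] step_m \<Phi>_nonneg by (simp add: q_def)
    also have "\<dots> \<le> exp (- (q * real K)) * (d ^ m * \<Phi> 0 0)"
      using W.power_sum_compare(2)[where k = 0] by (intro mult_left_mono) (auto simp: \<Phi>_def)
    \<comment> \<open>Passing from \<open>\<Phi> 0\<close> to \<open>\<Phi> m\<close> and back costs
      \<open>d ^ m / a ^ m\<close>, which is the factor \<open>\<kappa> ^ m\<close> under the
      logarithm.\<close>
    finally have "\<Phi> 0 K / 2 \<le> exp (- (q * real K)) * (\<kappa> ^ m * (\<Phi> 0 0 / 2))"
      using a by (simp add: \<kappa> power_divide field_simps)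
    also have "\<dots> \<le> \<epsilon>'"
    proof (intro exp_decay_le q assms(6))
      show "\<kappa> ^ m * (\<Phi> 0 0 / 2) = 0 \<or> ln (\<kappa> ^ m * (\<Phi> 0 0 / 2) / \<epsilon>') / q < real K"
        using K unfolding p_def[symmetric] q' powr gap0 using gap0 by auto
    qed (use \<kappa>_pos \<Phi>_nonneg in simp)
    finally show ?thesis by (simp only: gap)
  qed
  show ?thesis using part1 part2 unfolding X_def \<kappa>_def by blast
qed

end
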